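(* Let $\beta\in(\frac12,1)$ and $p\in(0,1)$. Then for all $y\in(0,\frac1\beta-1]$ we may write $$F_{\beta,p}(y)=y^{\log p/\log\beta}\,\nu_{\beta,p}(\log y),$$ where $\nu_{\beta,p}:(-\infty,\log(\frac1\beta-1)]\to(0,\infty)$ is a continuous, $\log(1/\beta)$-periodic function.
   Context: For $\beta,p\in(0,1)$ and $q=1-p$, let $(\varepsilon_j)_{j\in\mathbb{Z}}$ be i.i.d. with $\mathbb{P}(\varepsilon_j=0)=p$ and $\mathbb{P}(\varepsilon_j=1-\beta)=q$. $F_{\beta,p}$ denotes the distribution function of $\sum_{j=0}^\infty\beta^j\varepsilon_{-j}$, which is the stationary distribution function of the AR(1) process $X_{k+1}=\beta X_k+\varepsilon_{k+1}$. A function $\nu$ on a half-line $(-\infty,t_0]$ is called $\log(1/\beta)$-periodic if $\nu(t-\log(1/\beta))=\nu(t)$ for all $t\le t_0$. *)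

theory Defs
  imports "HOL-Probability.Probability"
begin

definition is_noise :: "real \<Rightarrow> real \<Rightarrow> 'a measure \<Rightarrow> (int \<Rightarrow> 'a \<Rightarrow> real) \<Rightarrow> bool" where
  "is_noise \<beta> p M \<epsilon> \<longleftrightarrow>
     prob_space M \<and>
     prob_space.indep_vars M (\<lambda>_. borel) \<epsilon> UNIV \<and>
     (\<forall>j. measure M {\<omega> \<in> space M. \<epsilon> j \<omega> = 0} = p \<and>
          measure M {\<omega> \<in> space M. \<epsilon> j \<omega> = 1 - \<beta>} = 1 - p)"

definition ar1_series :: "real \<Rightarrow> (int \<Rightarrow> 'a \<Rightarrow> real) \<Rightarrow> 'a \<Rightarrow> real" where
  "ar1_series \<beta> \<epsilon> \<omega> = (\<Sum>j. \<beta> ^ j * \<epsilon> (- int j) \<omega>)"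

(* The distribution function depends only on \<beta> and p, so it is defined from one concrete
   noise family (coin tosses, where True has probability p and stands for the value 0). The
   lemmas is_noise_coin and cdf_ar1_series below show that this is an i.i.d. family as
   required and that every other such family gives the same distribution function. *)

definition coin_space :: "real \<Rightarrow> (int \<Rightarrow> bool) measure" where
  "coin_space p = (\<Pi>\<^sub>M j\<in>UNIV. measure_pmf (bernoulli_pmf p))"

definition coin_noise :: "real \<Rightarrow> int \<Rightarrow> (int \<Rightarrow> bool) \<Rightarrow> real" where
  "coin_noise \<beta> j \<omega> = (if \<omega> j then 0 else 1 - \<beta>)"

definition F :: "real \<Rightarrow> real \<Rightarrow> real \<Rightarrow> real" where
  "F \<beta> p = cdf (distr (coin_space p) borel (ar1_series \<beta> (coin_noise \<beta>)))"

definition periodic_below :: "real \<Rightarrow> real \<Rightarrow> (real \<Rightarrow> real) \<Rightarrow> bool" where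
  "periodic_below T t\<^sub>0 \<nu> \<longleftrightarrow> (\<forall>t\<le>t\<^sub>0. \<nu> (t - T) = \<nu> t)"

lemma coin_noise_measurable [measurable]:
  "coin_noise \<beta> j \<in> borel_measurable (coin_space p)"
proof -
  have "(\<lambda>\<omega>. \<omega> j) \<in> coin_space p \<rightarrow>\<^sub>M measure_pmf (bernoulli_pmf p)"
    unfolding coin_space_def by measurable
  then show ?thesis
    unfolding coin_noise_def by (rule measurable_compose) simp
qed

lemma ar1_series_measurable:
  assumes "\<And>j. \<epsilon> j \<in> borel_measurable M"
  shows "ar1_series \<beta> \<epsilon> \<in> borel_measurable M"
  unfolding ar1_series_def using assms by measurable

lemma is_noise_coin:
  assumes "0 < \<beta>" "\<beta> < 1" "0 < p" "p < 1"
  shows "is_noise \<beta> p (coin_space p) (coin_noise \<beta>)"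
proof -
  let ?B = "\<lambda>_::int. measure_pmf (bernoulli_pmf p)"
  interpret product_prob_space ?B UNIV
    by unfold_locales
  have proj: "distr (PiM UNIV ?B) (?B j) (\<lambda>\<omega>. \<omega> j) = ?B j" for j
    by (rule PiM_component) simp
  have ps: "prob_space (PiM UNIV ?B)" by (rule P.prob_space_axioms)
  have id: "distr (PiM UNIV ?B) (PiM UNIV ?B) (\<lambda>\<omega>. \<lambda>j\<in>UNIV. \<omega> j) = PiM UNIV ?B"
    by (simp add: restrict_UNIV)
  have ind: "P.indep_vars ?B (\<lambda>j \<omega>. \<omega> j) UNIV"
    by (subst P.indep_vars_iff_distr_eq_PiM) (use id proj in auto)
  have ind': "P.indep_vars (\<lambda>_. borel) (coin_noise \<beta>) UNIV"
    using P.indep_vars_compose2[OF ind, of "\<lambda>_ b. if b then 0 else 1 - \<beta>" "\<lambda>_. borel"]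
    by (simp add: coin_noise_def[abs_def])
  have m: "measure (PiM UNIV ?B) {\<omega> \<in> space (PiM UNIV ?B). \<omega> j = b}
      = pmf (bernoulli_pmf p) b" for j b
  proof -
    have "pmf (bernoulli_pmf p) b = measure (distr (PiM UNIV ?B) (?B j) (\<lambda>\<omega>. \<omega> j)) {b}"
      by (simp add: proj measure_pmf_single)
    also have "\<dots> = measure (PiM UNIV ?B) ((\<lambda>\<omega>. \<omega> j) -` {b} \<inter> space (PiM UNIV ?B))"
      by (rule measure_distr) auto
    finally show ?thesis by (simp add: vimage_def Int_def conj_commute)
  qed
  have "measure (PiM UNIV ?B) {\<omega> \<in> space (PiM UNIV ?B). coin_noise \<beta> j \<omega> = 0} = p" for j
    using m[of j True] assms by (simp add: coin_noise_def space_PiM)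
  moreover have "measure (PiM UNIV ?B) {\<omega> \<in> space (PiM UNIV ?B). coin_noise \<beta> j \<omega> = 1 - \<beta>} = 1 - p" for j
    using m[of j False] assms by (simp add: coin_noise_def space_PiM)
  ultimately show ?thesis
    unfolding is_noise_def coin_space_def using ind' ps by blast
qed

lemma cdf_ar1_series:
  assumes \<beta>p: "0 < \<beta>" "\<beta> < 1" "0 < p" "p < 1"
    and noise: "is_noise \<beta> p M \<epsilon>"
  shows "cdf (distr M borel (ar1_series \<beta> \<epsilon>)) = F \<beta> p"
proof -
  interpret prob_space M using noise by (simp add: is_noise_def)
  have ind: "indep_vars (\<lambda>_. borel) \<epsilon> UNIV"
    and p0: "\<And>j. prob {\<omega> \<in> space M. \<epsilon> j \<omega> = 0} = p"
    and p1: "\<And>j. prob {\<omega> \<in> space M. \<epsilon> j \<omega> = 1 - \<beta>} = 1 - p"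
    using noise by (auto simp: is_noise_def)
  have meas [measurable]: "\<epsilon> j \<in> borel_measurable M" for j
    using ind by (auto simp: indep_vars_def)
  let ?B = "\<lambda>_::int. measure_pmf (bernoulli_pmf p)"
  define b where "b j \<omega> \<longleftrightarrow> \<epsilon> j \<omega> = 0" for j \<omega>
  have bm: "b j \<in> M \<rightarrow>\<^sub>M count_space UNIV" for j
    unfolding b_def by measurable
  have bm': "b j \<in> M \<rightarrow>\<^sub>M ?B j" for j
    using bm[of j] by (simp cong: measurable_cong_sets)
  have indb: "indep_vars ?B b UNIV"
    using indep_vars_compose2[OF ind, of "\<lambda>_ x. x = 0" ?B]
    by (simp add: b_def[abs_def] cong: measurable_cong_sets)
  have law: "distr M (?B j) (b j) = ?B j" for j
  proof (rule measure_eqI_finite[of _ UNIV])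
    fix c :: bool
    have "emeasure (distr M (?B j) (b j)) {c} = emeasure M (b j -` {c} \<inter> space M)"
      by (rule emeasure_distr[OF bm']) auto
    also have "\<dots> = ennreal (pmf (bernoulli_pmf p) c)"
    proof -
      have T: "prob (b j -` {True} \<inter> space M) = p"
        using p0[of j] by (simp add: b_def[abs_def] vimage_def Int_def conj_commute)
      have "b j -` {False} \<inter> space M = space M - (b j -` {True} \<inter> space M)" by auto
      then have "prob (b j -` {False} \<inter> space M) = 1 - p"
        using T prob_compl[OF measurable_sets[OF bm[of j], of "{True}"]] by simp
      with T show ?thesis using \<beta>p by (cases c) (auto simp: emeasure_eq_measure)
    qed
    also have "\<dots> = emeasure (?B j) {c}" by (simp add: emeasure_pmf_single)
    finally show "emeasure (distr M (?B j) (b j)) {c} = emeasure (?B j) {c}" .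
  qed auto
  have joint: "distr M (coin_space p) (\<lambda>\<omega> j. b j \<omega>) = coin_space p"
    using indep_vars_iff_distr_eq_PiM[THEN iffD1, OF _ _ indb] bm'
    by (simp add: law coin_space_def restrict_UNIV)
  have bmeas: "(\<lambda>\<omega> j. b j \<omega>) \<in> M \<rightarrow>\<^sub>M coin_space p"
    unfolding coin_space_def
    by (rule measurable_PiM_single') (use bm' in \<open>auto simp: space_PiM\<close>)
  have "AE \<omega> in M. \<epsilon> j \<omega> = coin_noise \<beta> j (\<lambda>j. b j \<omega>)" for j
  proof -
    have "prob ({\<omega> \<in> space M. \<epsilon> j \<omega> = 0} \<union> {\<omega> \<in> space M. \<epsilon> j \<omega> = 1 - \<beta>})
        = prob {\<omega> \<in> space M. \<epsilon> j \<omega> = 0} + prob {\<omega> \<in> space M. \<epsilon> j \<omega> = 1 - \<beta>}"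
      using \<beta>p by (intro finite_measure_Union) auto
    then have "prob ({\<omega> \<in> space M. \<epsilon> j \<omega> = 0} \<union> {\<omega> \<in> space M. \<epsilon> j \<omega> = 1 - \<beta>}) = 1"
      by (simp add: p0 p1)
    then have "AE \<omega> in M. \<omega> \<in> {\<omega> \<in> space M. \<epsilon> j \<omega> = 0} \<union> {\<omega> \<in> space M. \<epsilon> j \<omega> = 1 - \<beta>}"
      by (intro prob_eq_1[THEN iffD1]) auto
    then show ?thesis by eventually_elim (auto simp: coin_noise_def b_def)
  qed
  then have "AE \<omega> in M. \<forall>j. \<epsilon> j \<omega> = coin_noise \<beta> j (\<lambda>j. b j \<omega>)"
    by (simp add: AE_all_countable)
  then have ae: "AE \<omega> in M. ar1_series \<beta> \<epsilon> \<omega> = ar1_series \<beta> (coin_noise \<beta>) (\<lambda>j. b j \<omega>)"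
    by eventually_elim (simp add: ar1_series_def)
  have m1: "ar1_series \<beta> \<epsilon> \<in> borel_measurable M"
    by (rule ar1_series_measurable) measurable
  have m2: "ar1_series \<beta> (coin_noise \<beta>) \<in> borel_measurable (coin_space p)"
    by (rule ar1_series_measurable) measurable
  have "distr M borel (ar1_series \<beta> \<epsilon>)
      = distr M borel (\<lambda>\<omega>. ar1_series \<beta> (coin_noise \<beta>) (\<lambda>j. b j \<omega>))"
    by (rule distr_cong_AE[OF refl refl ae m1 measurable_compose[OF bmeas m2]])
  also have "\<dots> = distr (distr M (coin_space p) (\<lambda>\<omega> j. b j \<omega>)) borel (ar1_series \<beta> (coin_noise \<beta>))"
    by (simp add: distr_distr[OF m2 bmeas] comp_def)
  finally show ?thesis by (simp add: F_def joint)
qed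

end

theory Submission
  imports Defs
begin

text \<open>
  Splitting off \<open>\<epsilon>\<^sub>0\<close> shows that the stationary law is the mixture, with weights \<open>p\<close> and
  \<open>q = 1 - p\<close>, of its images under \<open>x \<mapsto> \<beta> x\<close> and \<open>x \<mapsto> \<beta> x + 1 - \<beta>\<close>; it lives on \<open>[0, 1]\<close>.
  This rules out atoms: a point \<open>x < 1 - \<beta>\<close> is not charged by the second image, whereas for
  \<open>x \<ge> 1 - \<beta>\<close> a bounded number \<open>n\<close> of inverse images \<open>x / \<beta>\<^sup>n\<close> leads out of \<open>[0, 1]\<close>. Either way
  the mass of \<open>{x}\<close> is at most a fixed fraction of the largest atom.
  So \<open>F\<close> is continuous, and \<open>F (\<beta> y) = p F y\<close> as long as \<open>\<beta> y \<le> 1 - \<beta>\<close>, which is the claimed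
  periodicity of \<open>\<nu> t = F (exp t) exp (- t log p / log \<beta>)\<close>.
\<close>

section \<open>The stationary law and its support\<close>

definition ar1_law :: "real \<Rightarrow> real \<Rightarrow> real measure" where
  "ar1_law \<beta> p = distr (coin_space p) borel (ar1_series \<beta> (coin_noise \<beta>))"

text \<open>The index map \<open>f\<close> is left free so that both the series itself and its copy
  started one step earlier are covered.\<close>

lemma ar1_series_coin_measurable [measurable]:
  "ar1_series \<beta> (\<lambda>j. coin_noise \<beta> (f j)) \<in> borel_measurable (coin_space p)"
  by (rule ar1_series_measurable) measurable

lemma prob_space_coin_space: "prob_space (coin_space p)"
  unfolding coin_space_def by (intro prob_space_PiM measure_pmf.prob_space_axioms)

lemma real_distribution_ar1_law: "real_distribution (ar1_law \<beta> p)"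
  unfolding ar1_law_def
  using ar1_series_coin_measurable[of \<beta> "\<lambda>j. j"]
  by (intro prob_space.real_distribution_distr prob_space_coin_space) simp

lemma F_eq_measure: "F \<beta> p y = measure (ar1_law \<beta> p) {..y}"
  by (simp add: F_def ar1_law_def cdf_def)

lemma summable_ar1_coin:
  assumes "0 < \<beta>" "\<beta> < 1"
  shows "summable (\<lambda>j. \<beta> ^ j * coin_noise \<beta> (f j) \<omega>)"
proof (rule summable_comparison_test')
  show "summable (\<lambda>j. \<beta> ^ j)"
    using assms by (simp add: summable_geometric)
  show "norm (\<beta> ^ j * coin_noise \<beta> (f j) \<omega>) \<le> \<beta> ^ j" if "0 \<le> j" for j
    using assms by (simp add: coin_noise_def abs_mult mult_left_le)
qed

text \<open>The noise value \<open>1 - \<beta>\<close> is the normalisation for which the largest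
  possible series is a geometric series with sum exactly 1.\<close>

lemma ar1_series_coin_bounds:
  assumes "0 < \<beta>" "\<beta> < 1"
  shows "ar1_series \<beta> (coin_noise \<beta>) \<omega> \<in> {0..1}"
proof -
  have "ar1_series \<beta> (coin_noise \<beta>) \<omega> \<le> (\<Sum>j. \<beta> ^ j * (1 - \<beta>))"
    unfolding ar1_series_def using assms
    by (intro suminf_le summable_ar1_coin summable_mult2 summable_geometric)
       (auto simp: coin_noise_def)
  also have "\<dots> = 1"
    using assms by (subst suminf_mult2[symmetric]) (auto simp: suminf_geometric summable_geometric)
  finally have "ar1_series \<beta> (coin_noise \<beta>) \<omega> \<le> 1" .
  moreover have "0 \<le> ar1_series \<beta> (coin_noise \<beta>) \<omega>"
    unfolding ar1_series_def using assms
    by (intro suminf_nonneg summable_ar1_coin) (auto simp: coin_noise_def)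
  ultimately show ?thesis by simp
qed

text \<open>The bounds on the series hold at every sample point, so the preimage of \<open>B\<close>
  is empty.\<close>

lemma ar1_law_outside:
  assumes "0 < \<beta>" "\<beta> < 1" and B: "B \<in> sets borel" "B \<inter> {0..1} = {}"
  shows "measure (ar1_law \<beta> p) B = 0"
proof -
  have "ar1_series \<beta> (coin_noise \<beta>) -` B = {}"
    using ar1_series_coin_bounds[OF assms(1,2)] B by blast
  then show ?thesis
    unfolding ar1_law_def using ar1_series_coin_measurable[of \<beta> "\<lambda>j. j" p] B
    by (subst measure_distr) auto
qed

section \<open>Self-similarity of the law\<close>

lemma ar1_series_coin_split:
  assumes "0 < \<beta>" "\<beta> < 1"
  shows "ar1_series \<beta> (coin_noise \<beta>) \<omega>
    = coin_noise \<beta> 0 \<omega> + \<beta> * ar1_series \<beta> (\<lambda>j. coin_noise \<beta> (j - 1)) \<omega>"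
proof -
  define f where "f j = \<beta> ^ j * coin_noise \<beta> (- int j) \<omega>" for j
  define g where "g j = \<beta> ^ j * coin_noise \<beta> (- int j - 1) \<omega>" for j
  have "- int (Suc j) = - int j - 1" for j by simp
  then have fg: "f (Suc j) = \<beta> * g j" for j
    unfolding f_def g_def by (simp only: power_Suc mult.assoc)
  have f: "summable f" and g: "summable g"
    unfolding f_def g_def by (intro summable_ar1_coin assms)+
  have "suminf f = f 0 + (\<Sum>j. f (Suc j))"
    using suminf_split_head[OF f] by simp
  also have "\<dots> = f 0 + \<beta> * suminf g"
    by (simp add: fg suminf_mult[OF g])
  finally show ?thesis
    by (simp add: ar1_series_def f_def[abs_def] g_def[abs_def])
qed

text \<open>Stationarity: all factors of the product measure agree, so reindexing by the injective
  map \<open>j - 1\<close> preserves it.\<close>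

lemma ar1_law_shift:
  "distr (coin_space p) borel (ar1_series \<beta> (\<lambda>j. coin_noise \<beta> (j - 1))) = ar1_law \<beta> p"
proof -
  let ?B = "\<lambda>_::int. measure_pmf (bernoulli_pmf p)"
  let ?s = "\<lambda>\<omega> j. \<omega> (j - 1) :: bool"
  have "distr (PiM UNIV ?B) (PiM UNIV ?B) (\<lambda>\<omega>. \<lambda>j\<in>UNIV. \<omega> (j - 1)) = PiM UNIV ?B"
    by (rule distr_PiM_reindex) (auto intro: measure_pmf.prob_space_axioms simp: inj_def)
  then have shift: "distr (coin_space p) (coin_space p) ?s = coin_space p"
    by (simp add: coin_space_def restrict_UNIV)
  have s: "?s \<in> coin_space p \<rightarrow>\<^sub>M coin_space p"
    unfolding coin_space_def by (rule measurable_PiM_single') (auto simp: space_PiM)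
  have "ar1_law \<beta> p = distr (distr (coin_space p) (coin_space p) ?s) borel (ar1_series \<beta> (coin_noise \<beta>))"
    by (simp add: shift ar1_law_def)
  also have "\<dots> = distr (coin_space p) borel (ar1_series \<beta> (coin_noise \<beta>) \<circ> ?s)"
    using ar1_series_coin_measurable[of \<beta> "\<lambda>j. j" p] s by (intro distr_distr) auto
  also have "ar1_series \<beta> (coin_noise \<beta>) \<circ> ?s = ar1_series \<beta> (\<lambda>j. coin_noise \<beta> (j - 1))"
    by (simp add: ar1_series_def coin_noise_def fun_eq_iff)
  finally show ?thesis ..
qed

text \<open>Condition on the noise at time 0: it takes two values and is independent of the shifted
  series \<open>Y\<close>, which again has the stationary law.\<close>

lemma ar1_law_self_similar:
  assumes \<beta>p: "0 < \<beta>" "\<beta> < 1" "0 < p" "p < 1" and B [measurable]: "B \<in> sets borel"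
  shows "measure (ar1_law \<beta> p) B = p * measure (ar1_law \<beta> p) {x. \<beta> * x \<in> B}
    + (1 - p) * measure (ar1_law \<beta> p) {x. \<beta> * x + (1 - \<beta>) \<in> B}"
proof -
  interpret prob_space "coin_space p" by (rule prob_space_coin_space)
  let ?M = "coin_space p" and ?\<epsilon> = "coin_noise \<beta>"
  define Y where "Y = ar1_series \<beta> (\<lambda>j. ?\<epsilon> (j - 1))"
  have Y [measurable]: "Y \<in> borel_measurable ?M" unfolding Y_def by measurable
  have ind: "indep_vars (\<lambda>_. borel) ?\<epsilon> UNIV"
    and pr: "prob {\<omega> \<in> space ?M. ?\<epsilon> 0 \<omega> = 0} = p" "prob {\<omega> \<in> space ?M. ?\<epsilon> 0 \<omega> = 1 - \<beta>} = 1 - p"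
    using is_noise_coin[OF \<beta>p] by (auto simp: is_noise_def)
  \<comment> \<open>\<open>Y\<close> reads only the noise at negative times, so it is a function of
    the block \<open>-{0}\<close>, which is independent of the block \<open>{0}\<close>.\<close>
  have "indep_var (PiM {0} (\<lambda>_. borel)) (\<lambda>\<omega>. restrict (\<lambda>j. ?\<epsilon> j \<omega>) {0})
     (PiM (-{0}) (\<lambda>_. borel)) (\<lambda>\<omega>. restrict (\<lambda>j. ?\<epsilon> j \<omega>) (-{0}))"
    by (rule indep_var_restrict[OF ind]) auto
  then have "indep_var borel ((\<lambda>f. f 0) \<circ> (\<lambda>\<omega>. restrict (\<lambda>j. ?\<epsilon> j \<omega>) {0})) borel
      (ar1_series \<beta> (\<lambda>j f. f (j - 1)) \<circ> (\<lambda>\<omega>. restrict (\<lambda>j. ?\<epsilon> j \<omega>) (-{0})))"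
    unfolding ar1_series_def by (rule indep_var_compose) measurable
  also have "(\<lambda>f. f 0) \<circ> (\<lambda>\<omega>. restrict (\<lambda>j. ?\<epsilon> j \<omega>) {0}) = ?\<epsilon> 0"
    by auto
  also have "ar1_series \<beta> (\<lambda>j f. f (j - 1)) \<circ> (\<lambda>\<omega>. restrict (\<lambda>j. ?\<epsilon> j \<omega>) (-{0})) = Y"
    by (auto simp: Y_def ar1_series_def fun_eq_iff)
  finally have ind0: "indep_var borel (?\<epsilon> 0) borel Y" .
  have part: "prob {\<omega> \<in> space ?M. ?\<epsilon> 0 \<omega> = c \<and> \<beta> * Y \<omega> + c \<in> B}
     = prob {\<omega> \<in> space ?M. ?\<epsilon> 0 \<omega> = c} * measure (ar1_law \<beta> p) {x. \<beta> * x + c \<in> B}" for c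
  proof -
    have C: "{x. \<beta> * x + c \<in> B} \<in> sets borel" by measurable
    have "measure (ar1_law \<beta> p) {x. \<beta> * x + c \<in> B} = prob {\<omega> \<in> space ?M. \<beta> * Y \<omega> + c \<in> B}"
      unfolding ar1_law_shift[symmetric] Y_def[symmetric]
      by (subst measure_distr[OF Y C]) (simp add: vimage_def Int_def conj_commute)
    then show ?thesis
      using indep_varD[OF ind0, of "{c}" "{x. \<beta> * x + c \<in> B}"] C
      by (simp add: vimage_def Int_def conj_commute)
  qed
  have "measure (ar1_law \<beta> p) B = prob {\<omega> \<in> space ?M. ar1_series \<beta> ?\<epsilon> \<omega> \<in> B}"
    unfolding ar1_law_def using ar1_series_coin_measurable[of \<beta> "\<lambda>j. j" p]
    by (subst measure_distr) (auto simp: vimage_def Int_def conj_commute)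
  also have "{\<omega> \<in> space ?M. ar1_series \<beta> ?\<epsilon> \<omega> \<in> B}
      = {\<omega> \<in> space ?M. ?\<epsilon> 0 \<omega> = 0 \<and> \<beta> * Y \<omega> + 0 \<in> B}
      \<union> {\<omega> \<in> space ?M. ?\<epsilon> 0 \<omega> = 1 - \<beta> \<and> \<beta> * Y \<omega> + (1 - \<beta>) \<in> B}"
    unfolding Y_def ar1_series_coin_split[OF \<beta>p(1,2)]
    by (auto simp: coin_noise_def algebra_simps)
  also have "prob \<dots> = prob {\<omega> \<in> space ?M. ?\<epsilon> 0 \<omega> = 0 \<and> \<beta> * Y \<omega> + 0 \<in> B}
      + prob {\<omega> \<in> space ?M. ?\<epsilon> 0 \<omega> = 1 - \<beta> \<and> \<beta> * Y \<omega> + (1 - \<beta>) \<in> B}"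
    using \<beta>p by (intro finite_measure_Union) auto
  finally show ?thesis
    unfolding part pr by simp
qed

section \<open>Absence of atoms\<close>

lemma ar1_law_singleton:
  assumes "0 < \<beta>" "\<beta> < 1" "0 < p" "p < 1"
  shows "measure (ar1_law \<beta> p) {x} = p * measure (ar1_law \<beta> p) {x / \<beta>}
    + (1 - p) * measure (ar1_law \<beta> p) {(x - (1 - \<beta>)) / \<beta>}"
proof -
  have "{u. \<beta> * u \<in> {x}} = {x / \<beta>}" "{u. \<beta> * u + (1 - \<beta>) \<in> {x}} = {(x - (1 - \<beta>)) / \<beta>}"
    using assms by (auto simp: field_simps)
  with ar1_law_self_similar[OF assms, of "{x}"] show ?thesis by simp
qed

lemma ar1_law_no_atoms:
  assumes \<beta>p: "0 < \<beta>" "\<beta> < 1" "0 < p" "p < 1"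
  shows "measure (ar1_law \<beta> p) {x} = 0"
proof -
  interpret real_distribution "ar1_law \<beta> p" by (rule real_distribution_ar1_law)
  define m where "m u = prob {u}" for u
  define s where "s = (SUP u. m u)"
  have m_le: "m u \<le> s" for u
    unfolding s_def by (rule cSUP_upper) (auto intro!: bdd_aboveI[of _ 1] simp: m_def)
  have m_nonneg: "0 \<le> m u" for u by (simp add: m_def)
  have m_out: "m u = 0" if "u \<notin> {0..1}" for u
    unfolding m_def using \<beta>p that by (intro ar1_law_outside) auto
  have step: "m u = p * m (u / \<beta>) + (1 - p) * m ((u - (1 - \<beta>)) / \<beta>)" for u
    unfolding m_def by (rule ar1_law_singleton[OF \<beta>p])
  \<comment> \<open>Only the first image is followed. Bounding the second one by \<open>s\<close> in
    each of the \<open>n\<close> rounds costs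
    \<open>(1 - p) * (1 + p + ... + p ^ (n - 1)) = 1 - p ^ n\<close>.\<close>
  have iter: "m u \<le> p ^ n * m (u / \<beta> ^ n) + (1 - p ^ n) * s" for u n
  proof (induction n)
    case (Suc n)
    have "m (u / \<beta> ^ n) \<le> p * m (u / \<beta> ^ n / \<beta>) + (1 - p) * s"
      using \<beta>p m_le by (subst step) (auto intro: mult_left_mono)
    then have "p ^ n * m (u / \<beta> ^ n) \<le> p ^ n * (p * m (u / \<beta> ^ n / \<beta>) + (1 - p) * s)"
      using \<beta>p by (intro mult_left_mono) auto
    with Suc show ?case by (simp add: algebra_simps)
  qed simp
  \<comment> \<open>This \<open>n\<close> serves all \<open>u \<ge> 1 - \<beta>\<close> at once:
    then \<open>u / \<beta> ^ n > 1\<close> lies outside the support. The contraction factor below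
    is thus uniform in \<open>u\<close>.\<close>
  obtain n where n: "\<beta> ^ n < 1 - \<beta>"
    using real_arch_pow_inv[of "1 - \<beta>" \<beta>] \<beta>p by auto
  have "s \<le> max p (1 - p ^ n) * s"
  proof (subst (1) s_def, rule cSUP_least)
    fix u
    have "m u \<le> p * s \<or> m u \<le> (1 - p ^ n) * s"
    proof (cases "u < 1 - \<beta>")
      case True
      then have "m ((u - (1 - \<beta>)) / \<beta>) = 0"
        using \<beta>p by (intro m_out) (auto simp: field_simps)
      then show ?thesis
        using step[of u] m_le[of "u / \<beta>"] \<beta>p by (auto intro: mult_left_mono)
    next
      case False
      then have "m (u / \<beta> ^ n) = 0"
        using \<beta>p n by (intro m_out) (auto simp: field_simps)
      then show ?thesis using iter[of u n] by simp
    qed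
    moreover have "0 \<le> s" using m_le[of 0] m_nonneg[of 0] by linarith
    ultimately show "m u \<le> max p (1 - p ^ n) * s"
      by (metis max.cobounded1 max.cobounded2 mult_right_mono order_trans)
  qed simp
  \<comment> \<open>A factor strictly below 1 is incompatible with \<open>s > 0\<close>.\<close>
  moreover have "max p (1 - p ^ n) < 1" using \<beta>p by simp
  ultimately have "s \<le> 0"
    by (smt (verit) mult_less_cancel_right2)
  then have "m x = 0" using m_le[of x] m_nonneg[of x] by linarith
  then show ?thesis by (simp add: m_def)
qed

section \<open>The distribution function\<close>

lemma isCont_F:
  assumes "0 < \<beta>" "\<beta> < 1" "0 < p" "p < 1"
  shows "isCont (F \<beta> p) y"
proof -
  interpret real_distribution "ar1_law \<beta> p" by (rule real_distribution_ar1_law)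
  show ?thesis
    using isCont_cdf[of y] ar1_law_no_atoms[OF assms] by (simp add: F_def ar1_law_def)
qed

lemma F_nonneg: "0 \<le> F \<beta> p y"
  by (simp add: F_eq_measure)

text \<open>The absence of an atom at 0 gives the case \<open>y = 0\<close>, which
  \<open>F_scale\<close> meets at the endpoint \<open>y = 1 / \<beta> - 1\<close>.\<close>

lemma F_nonpos:
  assumes "0 < \<beta>" "\<beta> < 1" "0 < p" "p < 1" "y \<le> 0"
  shows "F \<beta> p y = 0"
proof -
  interpret real_distribution "ar1_law \<beta> p" by (rule real_distribution_ar1_law)
  have "F \<beta> p y \<le> prob ({..<0} \<union> {0})"
    unfolding F_eq_measure using assms by (intro finite_measure_mono) auto
  also have "\<dots> \<le> prob {..<0} + prob {0}"
    by (intro measure_Un_le) auto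
  also have "prob {..<0} = 0"
    using assms by (intro ar1_law_outside) auto
  also have "prob {0} = 0"
    by (rule ar1_law_no_atoms[OF assms(1-4)])
  finally show ?thesis using F_nonneg[of \<beta> p y] by simp
qed

lemma F_ge_1:
  assumes "0 < \<beta>" "\<beta> < 1" "1 \<le> y"
  shows "F \<beta> p y = 1"
proof -
  interpret real_distribution "ar1_law \<beta> p" by (rule real_distribution_ar1_law)
  have "prob (UNIV - {..y}) = 0"
    using assms by (intro ar1_law_outside) auto
  then show ?thesis
    unfolding F_eq_measure using prob_compl[of "{..y}"] by simp
qed

lemma F_functional_equation:
  assumes "0 < \<beta>" "\<beta> < 1" "0 < p" "p < 1"
  shows "F \<beta> p y = p * F \<beta> p (y / \<beta>) + (1 - p) * F \<beta> p ((y - (1 - \<beta>)) / \<beta>)"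
proof -
  have "{u. \<beta> * u \<in> {..y}} = {..y / \<beta>}" "{u. \<beta> * u + (1 - \<beta>) \<in> {..y}} = {..(y - (1 - \<beta>)) / \<beta>}"
    using assms by (auto simp: field_simps)
  with ar1_law_self_similar[OF assms, of "{..y}"] show ?thesis by (simp add: F_eq_measure)
qed

text \<open>The bound on \<open>y\<close> says precisely that the second term of the functional
  equation at \<open>\<beta> * y\<close> has a nonpositive argument, so it vanishes.\<close>

lemma F_scale:
  assumes "0 < \<beta>" "\<beta> < 1" "0 < p" "p < 1" "y \<le> 1 / \<beta> - 1"
  shows "F \<beta> p (\<beta> * y) = p * F \<beta> p y"
proof -
  have "(\<beta> * y - (1 - \<beta>)) / \<beta> \<le> 0" using assms by (simp add: field_simps)
  then show ?thesis
    using F_functional_equation[OF assms(1-4), of "\<beta> * y"] F_nonpos[OF assms(1-4)] assms by simp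
qed

text \<open>Dropping the second term of the functional equation and iterating gives a lower bound by
  \<open>p ^ n * F \<beta> p (y / \<beta> ^ n)\<close>; for large \<open>n\<close> the argument
  exceeds 1, where \<open>F\<close> equals 1.\<close>

lemma F_pos:
  assumes "0 < \<beta>" "\<beta> < 1" "0 < p" "p < 1" "0 < y"
  shows "0 < F \<beta> p y"
proof -
  have "p ^ n * F \<beta> p (y / \<beta> ^ n) \<le> F \<beta> p y" for n
  proof (induction n)
    case (Suc n)
    have "p * F \<beta> p (y / \<beta> ^ n / \<beta>) \<le> F \<beta> p (y / \<beta> ^ n)"
      using F_functional_equation[OF assms(1-4), of "y / \<beta> ^ n"] assms F_nonneg by simp
    then have "p ^ n * (p * F \<beta> p (y / \<beta> ^ n / \<beta>)) \<le> p ^ n * F \<beta> p (y / \<beta> ^ n)"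
      using assms by (intro mult_left_mono) auto
    with Suc show ?case by (simp add: algebra_simps)
  qed simp
  moreover obtain n where "\<beta> ^ n < y" using real_arch_pow_inv assms by blast
  then have "F \<beta> p (y / \<beta> ^ n) = 1" using assms by (intro F_ge_1) auto
  ultimately have "p ^ n \<le> F \<beta> p y" by (metis mult.right_neutral)
  then show ?thesis using assms by (smt (verit) zero_less_power)
qed

theorem lemma2p2:
  fixes \<beta> p :: real
  assumes "1 / 2 < \<beta>" and "\<beta> < 1" and "0 < p" and "p < 1"
  shows "\<exists>\<nu> :: real \<Rightarrow> real.
           (\<forall>t \<le> ln (1 / \<beta> - 1). 0 < \<nu> t) \<and>
           continuous_on {..ln (1 / \<beta> - 1)} \<nu> \<and>
           periodic_below (ln (1 / \<beta>)) (ln (1 / \<beta> - 1)) \<nu> \<and>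
           (\<forall>y \<in> {0<..1 / \<beta> - 1}. F \<beta> p y = y powr (ln p / ln \<beta>) * \<nu> (ln y))"
proof (intro exI conjI allI impI ballI)
  have \<beta>p: "0 < \<beta>" "\<beta> < 1" "0 < p" "p < 1" using assms by auto
  define a where "a = ln p / ln \<beta>"
  \<comment> \<open>The claimed formula with \<open>y = exp t\<close> leaves no other choice on the
    half-line; the same expression is used for all real \<open>t\<close>.\<close>
  define \<nu> where "\<nu> t = F \<beta> p (exp t) * exp (- (t * a))" for t
  show "0 < \<nu> t" for t
    using F_pos[OF \<beta>p] by (simp add: \<nu>_def)
  have "continuous_on UNIV (F \<beta> p)"
    using isCont_F[OF \<beta>p] by (simp add: continuous_at_imp_continuous_on)
  then have "continuous_on S (\<lambda>t. F \<beta> p (exp t))" for S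
    by (rule continuous_on_compose2) (auto intro: continuous_intros)
  then show "continuous_on {..ln (1 / \<beta> - 1)} \<nu>"
    unfolding \<nu>_def by (intro continuous_intros)
  show "periodic_below (ln (1 / \<beta>)) (ln (1 / \<beta> - 1)) \<nu>"
    unfolding periodic_below_def
  proof (intro allI impI)
    fix t assume "t \<le> ln (1 / \<beta> - 1)"
    then have "exp t \<le> 1 / \<beta> - 1"
      using \<beta>p by (metis diff_gt_0_iff_gt exp_le_cancel_iff exp_ln less_divide_eq_1_pos)
    from F_scale[OF \<beta>p this] have "F \<beta> p (exp (t + ln \<beta>)) = p * F \<beta> p (exp t)"
      using \<beta>p by (simp add: exp_add mult.commute)
    \<comment> \<open>The exponent is made for this: \<open>a * ln \<beta> = ln p\<close>, so one
      period yields the factor \<open>1 / p\<close>, cancelling the \<open>p\<close> from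
      \<open>F_scale\<close>.\<close>
    moreover have "exp (- ((t + ln \<beta>) * a)) = exp (- (t * a)) / p"
    proof -
      have "(t + ln \<beta>) * a = t * a + ln p" using \<beta>p by (simp add: a_def field_simps)
      then show ?thesis using \<beta>p by (simp add: exp_diff)
    qed
    ultimately show "\<nu> (t - ln (1 / \<beta>)) = \<nu> t"
      using \<beta>p by (simp add: \<nu>_def ln_div)
  qed
  show "F \<beta> p y = y powr (ln p / ln \<beta>) * \<nu> (ln y)" if "y \<in> {0<..1 / \<beta> - 1}" for y
    using that by (simp add: \<nu>_def a_def[symmetric] powr_def exp_minus field_simps)
qed

end
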